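(* Let $p\ge 5$ and let $d^{(2)}_{n,p}$ be the number of permutations $\sigma\in S_n$ that have no $1324\ldots p$-match and satisfy $\mathrm{des}(\sigma)=2$. Define, for $0\le n\le 2p-3$, $$f(n,p)=\begin{cases}-3p^2+8p-7 & \text{if } n=0,\\ -3p^2+12p-12 & \text{if } n=1,\\ -3p^2+16p-21 & \text{if } n=2,\\ -\frac{3n^2}{2}+\left(4p-\frac{9}{2}\right)n-3p^2+8p-6 & \text{if } 3\le n\le p,\\ -\frac{n^2}{2}+\left(2p-\frac{7}{2}\right)n-2p^2+7p-6 & \text{if } p+1\le n\le 2p-3.\end{cases}$$ Then, as formal power series, $$\sum_{n\ge 0}d^{(2)}_{n,p}\frac{t^n}{n!}=e^{3t}+(2p-3-4t)e^{2t}+\left(3p^2-12p+10+(13-6p)t+(5-p)t^2-\sum_{n=3}^{p-2}2(p-n-1)\frac{t^n}{n!}\right)e^t$$ $$\qquad\qquad+\,2p-1+\sum_{n=1}^{p-2}2(p-n-1)\frac{t^n}{n!}+\sum_{n=0}^{2p-3}f(n,p)\frac{t^n}{n!}.$$ Consequently, for all $n\ge 2p-2$, $$d^{(2)}_{n,p}=3^n+(2p-3-2n)2^n+3p^2-12p+10+(13-6p)n+(5-p)n(n-1)-\sum_{k=3}^{p-2}\frac{2(p-k-1)}{k!}\,n(n-1)\cdots(n-k+1).$$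
   Context: For a sequence of distinct integers, $\mathrm{red}$ denotes the permutation obtained by replacing the $i$-th smallest integer of the sequence by $i$. $1324\ldots p$ denotes the permutation $1\,3\,2\,4\,5\cdots p\in S_p$ obtained from the identity by interchanging $2$ and $3$. A permutation $\sigma=\sigma_1\cdots\sigma_n\in S_n$ has a $1324\ldots p$-match if $\mathrm{red}(\sigma_i\sigma_{i+1}\cdots\sigma_{i+p-1})=1324\ldots p$ for some $i$ (consecutive positions). $\mathrm{des}(\sigma)=|\{i:\sigma_i>\sigma_{i+1}\}|$. *)

theory Defs
  imports Complex_Main "HOL-Combinatorics.Permutations"
    "HOL-Computational_Algebra.Formal_Power_Series"
begin

text \<open>
  An element of \<open>S\<^sub>n\<close> is a function \<open>\<sigma>\<close> with \<open>\<sigma> permutes {1..n}\<close>; its one-line notation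
  is \<open>\<sigma> 1, \<dots>, \<sigma> n\<close>, with positions and values both starting at 1.
\<close>

(* For a list of distinct entries, the i-th smallest entry is the one with exactly i entries
   below or equal to it. *)
definition red :: "'a::linorder list \<Rightarrow> nat list" where
  "red xs = map (\<lambda>x. card {y \<in> set xs. y \<le> x}) xs"

definition pattern1324 :: "nat \<Rightarrow> nat list" where
  "pattern1324 p = map (transpose 2 3) [1..<Suc p]"

definition has_match1324 :: "nat \<Rightarrow> nat \<Rightarrow> (nat \<Rightarrow> nat) \<Rightarrow> bool" where
  "has_match1324 p n \<sigma> \<longleftrightarrow>
     (\<exists>i\<ge>1. i + p \<le> Suc n \<and> red (map \<sigma> [i..<i + p]) = pattern1324 p)"

definition des :: "nat \<Rightarrow> (nat \<Rightarrow> nat) \<Rightarrow> nat" where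
  "des n \<sigma> = card {i \<in> {1..<n}. \<sigma> i > \<sigma> (Suc i)}"

definition d2 :: "nat \<Rightarrow> nat \<Rightarrow> nat" where
  "d2 n p = card {\<sigma>. \<sigma> permutes {1..n} \<and> \<not> has_match1324 p n \<sigma> \<and> des n \<sigma> = 2}"

(* Only meaningful for n \<le> 2 * p - 3; values beyond that range are never used. *)
definition corr :: "nat \<Rightarrow> nat \<Rightarrow> real" where
  "corr n p =
    (if n = 0 then - 3 * real p ^ 2 + 8 * real p - 7
     else if n = 1 then - 3 * real p ^ 2 + 12 * real p - 12
     else if n = 2 then - 3 * real p ^ 2 + 16 * real p - 21
     else if n \<le> p then
       - (3 * real n ^ 2 / 2) + (4 * real p - 9 / 2) * real n - 3 * real p ^ 2 + 8 * real p - 6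
     else
       - (real n ^ 2 / 2) + (2 * real p - 7 / 2) * real n - 2 * real p ^ 2 + 7 * real p - 6)"

end

theory Submission
  imports Defs
begin

text \<open>
  The pattern \<open>1 3 2 4 \<dots> p\<close> is an increasing word with its second and third letters exchanged.
  So \<open>\<sigma>\<close> has a match at position \<open>i\<close> exactly when exchanging the entries at positions \<open>i + 1\<close> and
  \<open>i + 2\<close> makes the window \<open>i, \<dots>, i + p - 1\<close> increasing (\<open>red_eq_pattern_iff\<close>), and this exchange
  removes exactly one descent, the one at \<open>i + 1\<close> (\<open>Des_comp_swap\<close>). Marking matches therefore
  reduces the number of descents, and a permutation with two descents has at most two matches, so
  inclusion-exclusion stops after three terms (\<open>d2_sieve\<close>):

  \<^item> All permutations with two descents, an Eulerian number (\<open>card_two_desc\<close>).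

  \<^item> One marked match: permutations with one descent together with an increasing window of length
    \<open>p\<close>. There are \<open>(n choose b) - 1\<close> permutations whose only descent is \<open>b\<close>, and the windows
    avoiding \<open>b\<close> are easily counted (\<open>card_match_one\<close>, \<open>single_match_sum\<close>).

  \<^item> Two marked matches: exchanging both pairs leads to the identity, so only the pairs of starting
    positions \<open>i < j\<close> are counted. The descent at \<open>j + 1\<close> has to lie outside the increasing part of
    the first window, which means \<open>j \<ge> i + p - 2\<close> (\<open>card_match_two\<close>, \<open>overlapping_pairs_sum\<close>).

  All descent counts come from the number \<open>(n choose b) * (b choose a)\<close> of permutations with descents
  only at \<open>a\<close> and \<open>b\<close>: such a permutation is the choice of the sets of values in its increasing
  blocks (\<open>card_desc_within\<close>). Adding the three terms gives one formula for all \<open>n\<close>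
  (\<open>d2_closed_form\<close>), in which the only dependence on the size of \<open>n\<close> relative to \<open>p\<close> is through
  the truncated differences \<open>n + 1 - p\<close> and \<open>n + 3 - 2 * p\<close>. The correction terms of the generating
  function record where these truncate.
\<close>

section \<open>Permutations with prescribed descents\<close>

definition Des :: "nat \<Rightarrow> (nat \<Rightarrow> nat) \<Rightarrow> nat set" where
  "Des n \<sigma> = {i \<in> {1..<n}. \<sigma> i > \<sigma> (Suc i)}"

lemma des_eq_card_Des: "des n \<sigma> = card (Des n \<sigma>)"
  by (simp add: des_def Des_def)

lemma finite_Des [simp]: "finite (Des n \<sigma>)"
  by (simp add: Des_def)

lemma Des_subset: "Des n \<sigma> \<subseteq> {1..<n}"
  by (auto simp: Des_def)

lemma Des_disjoint_iff_strict_mono_on: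
  assumes "\<sigma> permutes {1..n}" "1 \<le> l" "u \<le> Suc n"
  shows "Des n \<sigma> \<inter> {l..<u - 1} = {} \<longleftrightarrow> strict_mono_on {l..<u} \<sigma>"
proof
  assume disj: "Des n \<sigma> \<inter> {l..<u - 1} = {}"
  have step: "\<sigma> i < \<sigma> (Suc i)" if "l \<le> i" "Suc i < u" for i
  proof -
    have "i \<notin> Des n \<sigma>"
      using disj that by auto
    moreover have "i \<in> {1..<n}"
      using that assms by auto
    moreover have "\<sigma> i \<noteq> \<sigma> (Suc i)"
      using permutes_inj[OF assms(1)] by (metis injD n_not_Suc_n)
    ultimately show ?thesis
      by (auto simp: Des_def)
  qed
  have "\<sigma> i < \<sigma> (Suc (i + d))" if "l \<le> i" "Suc (i + d) < u" for i d
    using that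
  proof (induction d)
    case 0
    then show ?case using step by simp
  next
    case (Suc d)
    then show ?case using step[of "Suc (i + d)"] by fastforce
  qed
  then show "strict_mono_on {l..<u} \<sigma>"
    by (auto simp: strict_mono_on_def less_iff_Suc_add)
next
  assume mono: "strict_mono_on {l..<u} \<sigma>"
  show "Des n \<sigma> \<inter> {l..<u - 1} = {}"
  proof (rule ccontr)
    assume "Des n \<sigma> \<inter> {l..<u - 1} \<noteq> {}"
    then obtain i where "i \<in> Des n \<sigma>" "i \<in> {l..<u - 1}" by blast
    then have "i \<in> Des n \<sigma>" "l \<le> i" "Suc i < u" by auto
    then show False
      using strict_mono_onD[OF mono, of i "Suc i"] by (auto simp: Des_def)
  qed
qed

text \<open>
  An increasing block of a permutation is determined by its set of values.
\<close>
lemma map_eq_sorted_list_of_set: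
  fixes f :: "nat \<Rightarrow> nat"
  assumes "strict_mono_on {l..<u} f"
  shows "map f [l..<u] = sorted_list_of_set (f ` {l..<u})"
proof (rule sorted_distinct_set_unique)
  have "sorted_wrt (<) (map f [l..<u])"
    using strict_mono_onD[OF assms]
    by (simp add: sorted_wrt_map sorted_wrt_iff_nth_less less_diff_conv add.commute)
  then show "sorted (map f [l..<u])" "distinct (map f [l..<u])"
    by (auto simp: strict_sorted_iff)
qed auto

definition desc_within :: "nat \<Rightarrow> nat set \<Rightarrow> (nat \<Rightarrow> nat) set" where
  "desc_within n D = {\<sigma>. \<sigma> permutes {1..n} \<and> Des n \<sigma> \<subseteq> D}"

lemma finite_desc_within [simp]: "finite (desc_within n D)"
  unfolding desc_within_def by (simp add: finite_permutations)

lemma desc_within_blocks: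
  assumes "\<sigma> \<in> desc_within n {a, b}" "a \<le> b" "b \<le> n"
  shows "map \<sigma> [1..<Suc n] = sorted_list_of_set (\<sigma> ` {1..a})
     @ sorted_list_of_set (\<sigma> ` {1..b} - \<sigma> ` {1..a})
     @ sorted_list_of_set ({1..n} - \<sigma> ` {1..b})"
proof -
  have perm: "\<sigma> permutes {1..n}" and D: "Des n \<sigma> \<subseteq> {a, b}"
    using assms(1) by (auto simp: desc_within_def)
  note inj = permutes_inj[OF perm]
  have block: "map \<sigma> [l..<u] = sorted_list_of_set (\<sigma> ` {l..<u})"
    if "1 \<le> l" "u \<le> Suc n" "a \<notin> {l..<u - 1}" "b \<notin> {l..<u - 1}" for l u
    by (rule map_eq_sorted_list_of_set,
        subst Des_disjoint_iff_strict_mono_on[OF perm, symmetric]) (use that D in auto)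
  have "[1..<Suc n] = [1..<Suc a] @ [Suc a..<Suc b] @ [Suc b..<Suc n]"
    using upt_add_eq_append[of 1 "Suc a" "n - a"] upt_add_eq_append[of "Suc a" "Suc b" "n - b"] assms(2,3)
    by simp
  moreover have "\<sigma> ` {Suc a..<Suc b} = \<sigma> ` {1..b} - \<sigma> ` {1..a}"
    unfolding image_set_diff[OF inj, symmetric] by (rule arg_cong[where f = "image \<sigma>"]) auto
  moreover have "\<sigma> ` {Suc b..<Suc n} = {1..n} - \<sigma> ` {1..b}"
  proof -
    have "\<sigma> ` ({1..n} - {1..b}) = {1..n} - \<sigma> ` {1..b}"
      unfolding image_set_diff[OF inj] permutes_image[OF perm] ..
    moreover have "{1..n} - {1..b} = {Suc b..<Suc n}" by auto
    ultimately show ?thesis by simp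
  qed
  moreover have "\<sigma> ` {1..<Suc a} = \<sigma> ` {1..a}"
    by (simp add: atLeastLessThanSuc_atLeastAtMost)
  ultimately show ?thesis
    using block[of 1 "Suc a"] block[of "Suc a" "Suc b"] block[of "Suc b" "Suc n"] assms(2,3)
    by simp
qed

text \<open>
  The converse of \<open>desc_within_blocks\<close>: any chain of value sets is realised, by listing
  \<open>X\<close>, \<open>Y - X\<close> and the remaining values each in increasing order.
\<close>
lemma desc_within_from_sets:
  assumes "X \<subseteq> Y" "Y \<subseteq> {1..n}"
  obtains \<sigma> where "\<sigma> \<in> desc_within n {card X, card Y}"
    "\<sigma> ` {1..card X} = X" "\<sigma> ` {1..card Y} = Y"
proof -
  have fin: "finite X" "finite Y"
    using assms by (auto intro: finite_subset)
  define xs where "xs = sorted_list_of_set X"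
  define ys where "ys = sorted_list_of_set (Y - X)"
  define zs where "zs = sorted_list_of_set ({1..n} - Y)"
  define w where "w = xs @ ys @ zs"
  have XY: "card X \<le> card Y" "card Y \<le> n"
    using assms fin card_mono[of "{1..n}" Y] by (auto intro: card_mono)
  have len: "length xs = card X" "length (xs @ ys) = card Y" "length w = n"
    using fin assms XY by (simp_all add: xs_def ys_def zs_def w_def card_Diff_subset)
  have set: "set xs = X" "set (xs @ ys) = Y" "set w = {1..n}"
    using fin assms by (auto simp: xs_def ys_def zs_def w_def)
  have dist: "distinct w"
    using fin assms by (auto simp: xs_def ys_def zs_def w_def)
  define \<sigma> where "\<sigma> i = (if i \<in> {1..n} then w ! (i - 1) else i)" for i
  have img: "\<sigma> ` {1..k} = set (take k w)" if "k \<le> n" for k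
  proof -
    have "set (take k w) = (!) w ` {..<k}"
      using that len by (simp add: nth_image lessThan_atLeast0)
    also have "{..<k} = (\<lambda>i. i - 1) ` {1..k}"
      by (force simp: image_iff intro: bexI[where x = "Suc _"])
    finally show ?thesis
      using that by (auto simp: \<sigma>_def image_image)
  qed
  have perm: "\<sigma> permutes {1..n}"
  proof (rule bij_imp_permutes)
    show "bij_betw \<sigma> {1..n} {1..n}"
      using img[of n] len set by (intro bij_betw_imageI) (auto intro: eq_card_imp_inj_on)
  qed (auto simp: \<sigma>_def)
  have "Des n \<sigma> \<subseteq> {card X, card Y}"
  proof
    fix i assume "i \<in> Des n \<sigma>"
    then obtain k where i: "i = Suc k" and gt: "w ! Suc k < w ! k" and "Suc k < n"
      by (cases i) (auto simp: Des_def \<sigma>_def)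
    have sorted: "sorted xs" "sorted ys" "sorted zs"
      by (auto simp: xs_def ys_def zs_def)
    have nth: "k < card X \<Longrightarrow> w ! k = xs ! k"
      "card X \<le> k \<Longrightarrow> k < card Y \<Longrightarrow> w ! k = ys ! (k - card X)"
      "card Y \<le> k \<Longrightarrow> w ! k = zs ! (k - card Y)" for k
      using len XY by (auto simp: w_def nth_append)
    show "i \<in> {card X, card Y}"
    proof (rule ccontr)
      assume "i \<notin> {card X, card Y}"
      then consider "i < card X" | "card X < i" "i < card Y" | "card Y < i" by force
      then show False
      proof cases
        case 1
        then have "xs ! k \<le> xs ! Suc k"
          using i len by (intro sorted_nth_mono[OF sorted(1)]) auto
        then show False
          using 1 gt i nth(1)[of k] nth(1)[of "Suc k"] by auto
      next
        case 2
        then have "ys ! (k - card X) \<le> ys ! (Suc k - card X)"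
          using i len by (intro sorted_nth_mono[OF sorted(2)]) auto
        then show False
          using 2 gt i nth(2)[of k] nth(2)[of "Suc k"] by auto
      next
        case 3
        then have "zs ! (k - card Y) \<le> zs ! (Suc k - card Y)"
          using i len \<open>Suc k < n\<close> by (intro sorted_nth_mono[OF sorted(3)]) (auto simp: w_def)
        then show False
          using 3 gt i nth(3)[of k] nth(3)[of "Suc k"] by auto
      qed
    qed
  qed
  moreover have "\<sigma> ` {1..card X} = X"
    using img[of "card X"] XY len set by (simp add: w_def)
  moreover have "\<sigma> ` {1..card Y} = Y"
    using img[of "card Y"] XY len set by (simp add: w_def)
  ultimately show thesis
    using that perm by (auto simp: desc_within_def)
qed

text \<open>
  \<open>\<sigma> \<mapsto> (\<sigma> ` {1..b}, \<sigma> ` {1..a})\<close> is a bijection onto pairs of nested subsets of sizes \<open>b\<close> and \<open>a\<close>.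
  The cases \<open>a = b\<close> and \<open>b = n\<close> are included, because \<open>n\<close> is never a descent; they give the counts for
  fewer cuts.
\<close>
lemma card_desc_within:
  assumes "a \<le> b" "b \<le> n"
  shows "card (desc_within n {a, b}) = (n choose b) * (b choose a)"
proof -
  define N where "N = (SIGMA Y : {Y. Y \<subseteq> {1..n} \<and> card Y = b}. {X. X \<subseteq> Y \<and> card X = a})"
  have "bij_betw (\<lambda>\<sigma>. (\<sigma> ` {1..b}, \<sigma> ` {1..a})) (desc_within n {a, b}) N"
  proof (rule bij_betw_imageI)
    show "inj_on (\<lambda>\<sigma>. (\<sigma> ` {1..b}, \<sigma> ` {1..a})) (desc_within n {a, b})"
    proof (rule inj_onI)
      fix \<sigma> \<tau> assume \<sigma>: "\<sigma> \<in> desc_within n {a, b}" and \<tau>: "\<tau> \<in> desc_within n {a, b}"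
        and "(\<sigma> ` {1..b}, \<sigma> ` {1..a}) = (\<tau> ` {1..b}, \<tau> ` {1..a})"
      then have "map \<sigma> [1..<Suc n] = map \<tau> [1..<Suc n]"
        by (simp only: desc_within_blocks[OF \<sigma> assms] desc_within_blocks[OF \<tau> assms] prod.inject)
      then have "\<sigma> i = \<tau> i" if "i \<in> {1..n}" for i
        using that by (simp del: upt_Suc)
      moreover have "\<sigma> i = \<tau> i" if "i \<notin> {1..n}" for i
        using that \<sigma> \<tau> by (auto simp: desc_within_def permutes_def)
      ultimately show "\<sigma> = \<tau>" by blast
    qed
    show "(\<lambda>\<sigma>. (\<sigma> ` {1..b}, \<sigma> ` {1..a})) ` desc_within n {a, b} = N"
    proof (intro subset_antisym subsetI)
      fix z assume "z \<in> (\<lambda>\<sigma>. (\<sigma> ` {1..b}, \<sigma> ` {1..a})) ` desc_within n {a, b}"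
      then obtain \<sigma> where z: "z = (\<sigma> ` {1..b}, \<sigma> ` {1..a})" and \<sigma>: "\<sigma> permutes {1..n}"
        by (auto simp: desc_within_def)
      have "\<sigma> ` {1..b} \<subseteq> {1..n}"
        using permutes_image[OF \<sigma>] assms by (metis atLeastatMost_subset_iff image_mono order_refl)
      moreover have "card (\<sigma> ` {1..k}) = k" for k
        by (simp add: card_image inj_on_subset[OF permutes_inj[OF \<sigma>]])
      moreover have "\<sigma> ` {1..a} \<subseteq> \<sigma> ` {1..b}"
        using assms by (intro image_mono) auto
      ultimately show "z \<in> N"
        by (simp add: N_def z)
    next
      fix z assume "z \<in> N"
      then obtain X Y where "z = (Y, X)" "X \<subseteq> Y" "Y \<subseteq> {1..n}" "card X = a" "card Y = b"
        by (auto simp: N_def)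
      then show "z \<in> (\<lambda>\<sigma>. (\<sigma> ` {1..b}, \<sigma> ` {1..a})) ` desc_within n {a, b}"
        by (metis (no_types, lifting) desc_within_from_sets image_eqI)
    qed
  qed
  then have "card (desc_within n {a, b}) = card N"
    by (rule bij_betw_same_card)
  also have "\<dots> = (\<Sum>Y\<in>{Y. Y \<subseteq> {1..n} \<and> card Y = b}. card {X. X \<subseteq> Y \<and> card X = a})"
    unfolding N_def
    by (rule card_SigmaI) (auto intro: finite_subset[of _ "Pow _"] finite_subset)
  also have "\<dots> = (\<Sum>Y\<in>{Y. Y \<subseteq> {1..n} \<and> card Y = b}. b choose a)"
    by (intro sum.cong refl) (use n_subsets finite_subset[OF _ finite_atLeastAtMost] in blast)
  also have "\<dots> = (n choose b) * (b choose a)"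
    by (simp add: n_subsets)
  finally show ?thesis .
qed

lemma card_desc_within_single: "b \<le> n \<Longrightarrow> card (desc_within n {b}) = n choose b"
  using card_desc_within[of b b n] by simp

lemma card_desc_within_empty: "card (desc_within n {}) = 1"
proof -
  have "desc_within n {} = desc_within n {n}"
    using Des_subset by (fastforce simp: desc_within_def)
  then show ?thesis
    by (simp add: card_desc_within_single)
qed

definition desc_exactly :: "nat \<Rightarrow> nat set \<Rightarrow> (nat \<Rightarrow> nat) set" where
  "desc_exactly n D = {\<sigma>. \<sigma> permutes {1..n} \<and> Des n \<sigma> = D}"

lemma finite_desc_exactly [simp]: "finite (desc_exactly n D)"
  unfolding desc_exactly_def by (simp add: finite_permutations)

lemma desc_exactly_empty: "desc_exactly n {} = {id}"
proof -
  have "id \<in> desc_exactly n {}"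
    by (auto simp: desc_exactly_def Des_def permutes_id)
  moreover have "card (desc_exactly n {}) = 1"
    using card_desc_within_empty by (simp add: desc_within_def desc_exactly_def)
  ultimately show ?thesis
    by (auto simp: card_1_singleton_iff)
qed

lemma card_desc_exactly_single:
  assumes "b \<le> n"
  shows "real (card (desc_exactly n {b})) = real (n choose b) - 1"
proof -
  have "desc_within n {b} = desc_exactly n {b} \<union> desc_within n {}"
       "desc_exactly n {b} \<inter> desc_within n {} = {}"
    by (auto simp: desc_within_def desc_exactly_def)
  then have "card (desc_within n {b}) = card (desc_exactly n {b}) + card (desc_within n {})"
    by (simp add: card_Un_disjoint)
  then show ?thesis
    using assms by (simp add: card_desc_within_single card_desc_within_empty)
qed

text \<open>
  Inclusion-exclusion over subsets of \<open>{a, b}\<close>. The right-hand side vanishes for \<open>a = 0\<close> and for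
  \<open>b = n\<close>, so sums over pairs of descents may run over all \<open>0 \<le> a < b \<le> n\<close>.
\<close>
lemma card_desc_exactly_pair:
  assumes "a < b" "b \<le> n"
  shows "real (card (desc_exactly n {a, b}))
    = real (n choose b) * real (b choose a) - real (n choose a) - real (n choose b) + 1"
proof -
  have "D \<subseteq> {a, b} \<longleftrightarrow> D = {a, b} \<or> D \<subseteq> {a} \<or> D \<subseteq> {b}" for D :: "nat set"
    by blast
  then have "desc_within n {a, b} = desc_exactly n {a, b} \<union> (desc_within n {a} \<union> desc_within n {b})"
    by (simp add: desc_within_def desc_exactly_def set_eq_iff) blast
  moreover have "desc_exactly n {a, b} \<inter> (desc_within n {a} \<union> desc_within n {b}) = {}"
    using assms by (auto simp: desc_within_def desc_exactly_def)
  ultimately have "card (desc_within n {a, b})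
      = card (desc_exactly n {a, b}) + card (desc_within n {a} \<union> desc_within n {b})"
    by (simp add: card_Un_disjoint)
  moreover have "desc_within n {a} \<inter> desc_within n {b} = desc_within n {}"
    using assms by (auto simp: desc_within_def)
  then have "card (desc_within n {a}) + card (desc_within n {b})
      = card (desc_within n {a} \<union> desc_within n {b}) + 1"
    using card_Un_Int[of "desc_within n {a}" "desc_within n {b}"]
    by (simp add: card_desc_within_empty)
  ultimately show ?thesis
    using assms by (simp add: card_desc_within_single card_desc_within flip: of_nat_mult)
qed

definition two_desc :: "nat \<Rightarrow> (nat \<Rightarrow> nat) set" where
  "two_desc n = {\<sigma>. \<sigma> permutes {1..n} \<and> card (Des n \<sigma>) = 2}"

lemma finite_two_desc [simp]: "finite (two_desc n)"
  unfolding two_desc_def by (simp add: finite_permutations)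

text \<open>
  The Eulerian number for two descents. Summing \<open>card_desc_exactly_pair\<close> over \<open>a < b\<close>, the leading
  term becomes \<open>\<Sum>b. (n choose b) * 2 ^ b = 3 ^ n\<close> once the diagonal \<open>a = b\<close> is added.
\<close>
lemma card_two_desc:
  "real (card (two_desc n))
    = 3 ^ n - (real n + 1) * 2 ^ n + real n * (real n + 1) / 2"
proof -
  let ?C = "\<lambda>a b. real (a choose b)"
  define g where "g a b = ?C n b * ?C b a - ?C n a - ?C n b + 1" for a b
  have "two_desc n
      = (\<Union>(b, a) \<in> (SIGMA b : {..n}. {..<b}). desc_exactly n {a, b})"
  proof (intro subset_antisym subsetI)
    fix \<sigma> assume \<sigma>: "\<sigma> \<in> two_desc n"
    then obtain a b where "Des n \<sigma> = {a, b}" "a < b"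
      by (auto simp: two_desc_def card_2_iff) (metis insert_commute linorder_neqE_nat)
    moreover have "b \<le> n"
      using calculation Des_subset[of n \<sigma>] by auto
    ultimately show "\<sigma> \<in> (\<Union>(b, a) \<in> (SIGMA b : {..n}. {..<b}). desc_exactly n {a, b})"
      using \<sigma> by (auto simp: desc_exactly_def two_desc_def)
  qed (auto simp: desc_exactly_def two_desc_def)
  also have "card \<dots> = (\<Sum>(b, a) \<in> (SIGMA b : {..n}. {..<b}). card (desc_exactly n {a, b}))"
    unfolding case_prod_unfold
    by (rule card_UN_disjoint) (simp_all, auto simp: desc_exactly_def doubleton_eq_iff)
  also have "\<dots> = (\<Sum>b\<le>n. \<Sum>a<b. card (desc_exactly n {a, b}))"
    by (simp add: sum.Sigma)
  also have "real \<dots> = (\<Sum>b\<le>n. \<Sum>a<b. g a b)"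
    unfolding of_nat_sum by (intro sum.cong refl) (simp add: g_def card_desc_exactly_pair)
  also have "\<dots> = (\<Sum>b\<le>n. (\<Sum>a\<le>b. g a b) - g b b)"
    by (simp flip: lessThan_Suc_atMost)
  also have "\<dots> = (\<Sum>b\<le>n. \<Sum>a\<le>b. g a b) - (\<Sum>b\<le>n. g b b)"
    by (simp add: sum_subtractf)
  also have "(\<Sum>b\<le>n. g b b) = real n + 1 - 2 ^ n"
    using choose_row_sum[of n] by (simp add: g_def sum.distrib sum_subtractf sum_negf flip: of_nat_sum)
  also have "(\<Sum>b\<le>n. \<Sum>a\<le>b. g a b) = 3 ^ n - (real n + 2) * 2 ^ n + (real n + 1) * (real n + 2) / 2"
  proof -
    have row: "(\<Sum>a\<le>b. ?C b a) = 2 ^ b" for b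
      using choose_row_sum[of b] by (simp flip: of_nat_sum)
    have "(\<Sum>b\<le>n. \<Sum>a\<le>b. ?C n b * ?C b a) = (\<Sum>b\<le>n. ?C n b * 2 ^ b)"
      by (simp add: row flip: sum_distrib_left)
    also have "\<dots> = 3 ^ n"
      using binomial_ring[of 2 "1::real" n] by simp
    finally have 1: "(\<Sum>b\<le>n. \<Sum>a\<le>b. ?C n b * ?C b a) = 3 ^ n" .
    have "(\<Sum>b\<le>n. \<Sum>a\<le>b. ?C n a) = (\<Sum>a\<le>n. \<Sum>b=a..n. ?C n a)"
      unfolding sum.Sigma[OF finite_atMost ballI[OF finite_atMost]]
        sum.Sigma[OF finite_atMost ballI[OF finite_atLeastAtMost]]
      by (rule sum.reindex_bij_witness[where i = prod.swap and j = prod.swap]) auto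
    also have "\<dots> = (\<Sum>a\<le>n. ?C n a * (real n + 1 - real a))"
      by (intro sum.cong refl) (simp add: of_nat_diff algebra_simps)
    finally have "(\<Sum>b\<le>n. \<Sum>a\<le>b. ?C n a) + (\<Sum>b\<le>n. \<Sum>a\<le>b. ?C n b)
        = (\<Sum>a\<le>n. ?C n a * (real n + 1 - real a)) + (\<Sum>a\<le>n. ?C n a * (real a + 1))"
      by (simp add: algebra_simps)
    also have "\<dots> = (\<Sum>a\<le>n. ?C n a * (real n + 2))"
      unfolding sum.distrib[symmetric] by (simp add: algebra_simps)
    also have "\<dots> = (real n + 2) * 2 ^ n"
      by (simp add: row flip: sum_distrib_right)
    finally have 2: "(\<Sum>b\<le>n. \<Sum>a\<le>b. ?C n a) + (\<Sum>b\<le>n. \<Sum>a\<le>b. ?C n b) = (real n + 2) * 2 ^ n" .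
    have 3: "(\<Sum>b\<le>n. \<Sum>a\<le>b. 1) = (real n + 1) * (real n + 2) / 2"
      by (induction n) (auto simp: field_simps)
    show ?thesis
      using 1 2 3 unfolding g_def by (simp only: sum.distrib sum_subtractf)
  qed
  finally show ?thesis
    by (simp add: field_simps)
qed

section \<open>Matches as exchanges in an increasing window\<close>

text \<open>
  The letters of the pattern that are out of order, 3 and 2, stand in the second and third place; in a
  window that starts at \<open>i\<close> these are the positions \<open>i + 1\<close> and \<open>i + 2\<close>.
\<close>
abbreviation swap :: "nat \<Rightarrow> nat \<Rightarrow> nat" where
  "swap i \<equiv> transpose (Suc i) (Suc (Suc i))"

lemma permutes_comp_swap:
  assumes "\<sigma> permutes {1..n}" "1 \<le> i" "i + 2 \<le> n"
  shows "(\<sigma> \<circ> swap i) permutes {1..n}"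
  by (rule permutes_compose[OF permutes_swap_id assms(1)]) (use assms in auto)

lemma swap_comp_swap: "\<sigma> \<circ> swap i \<circ> swap i = \<sigma>"
  by (simp add: comp_assoc)

text \<open>
  The exchange affects only the comparisons at \<open>i\<close>, \<open>i + 1\<close> and \<open>i + 2\<close>, and these involve four
  entries that all belong to the increasing window since \<open>p \<ge> 4\<close>.
\<close>
lemma Des_comp_swap:
  assumes "\<tau> permutes {1..n}" "1 \<le> i" "i + p \<le> Suc n" "4 \<le> p"
    and "Des n \<tau> \<inter> {i..<i + p - 1} = {}"
  shows "Des n (\<tau> \<circ> swap i) = insert (Suc i) (Des n \<tau>)"
proof -
  have mono: "strict_mono_on {i..<i + p} \<tau>"
    using Des_disjoint_iff_strict_mono_on[OF assms(1,2,3)] assms(5) by simp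
  have inc: "\<tau> j < \<tau> k" if "i \<le> j" "j < k" "k < i + p" for j k
    using strict_mono_onD[OF mono] that by simp
  have "j \<in> Des n (\<tau> \<circ> swap i) \<longleftrightarrow> j = Suc i \<or> j \<in> Des n \<tau>" for j
  proof -
    consider "j = i" | "j = Suc i" | "j = Suc (Suc i)" | "j < i \<or> j > Suc (Suc i)" by linarith
    then show ?thesis
    proof cases
      case 1
      then show ?thesis using inc[of i "Suc i"] inc[of i "Suc (Suc i)"] assms(4)
        by (auto simp: Des_def transpose_def)
    next
      case 2
      then show ?thesis using inc[of "Suc i" "Suc (Suc i)"] assms(2-4)
        by (auto simp: Des_def transpose_def)
    next
      case 3
      then show ?thesis
        using inc[of "Suc i" "Suc (Suc (Suc i))"] inc[of "Suc (Suc i)" "Suc (Suc (Suc i))"] assms(4)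
        by (auto simp: Des_def transpose_def)
    next
      case 4
      then show ?thesis by (auto simp: Des_def transpose_def)
    qed
  qed
  then show ?thesis by blast
qed

text \<open>
  Matches are described by descents alone; \<open>red_eq_pattern_iff\<close> connects this with the standardised
  word of the window.
\<close>
definition match_at :: "nat \<Rightarrow> nat \<Rightarrow> nat \<Rightarrow> (nat \<Rightarrow> nat) \<Rightarrow> bool" where
  "match_at p n i \<sigma> \<longleftrightarrow> Des n (\<sigma> \<circ> swap i) \<inter> {i..<i + p - 1} = {}"

lemma ranks_consecutive_iff_strict_mono_on:
  fixes \<tau> :: "nat \<Rightarrow> nat"
  assumes "inj \<tau>"
  shows "(\<forall>j\<in>{i..<i + p}. card {y \<in> \<tau> ` {i..<i + p}. y \<le> \<tau> j} = Suc j - i)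
    \<longleftrightarrow> strict_mono_on {i..<i + p} \<tau>"
proof
  assume rank: "\<forall>j\<in>{i..<i + p}. card {y \<in> \<tau> ` {i..<i + p}. y \<le> \<tau> j} = Suc j - i"
  show "strict_mono_on {i..<i + p} \<tau>"
  proof (rule strict_mono_onI, rule ccontr)
    fix j k assume jk: "j \<in> {i..<i + p}" "k \<in> {i..<i + p}" "j < k" "\<not> \<tau> j < \<tau> k"
    then have "card {y \<in> \<tau> ` {i..<i + p}. y \<le> \<tau> k} \<le> card {y \<in> \<tau> ` {i..<i + p}. y \<le> \<tau> j}"
      by (intro card_mono) auto
    then show False using rank jk by auto
  qed
next
  assume mono: "strict_mono_on {i..<i + p} \<tau>"
  show "\<forall>j\<in>{i..<i + p}. card {y \<in> \<tau> ` {i..<i + p}. y \<le> \<tau> j} = Suc j - i"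
  proof
    fix j assume j: "j \<in> {i..<i + p}"
    have "\<tau> k \<le> \<tau> j \<longleftrightarrow> k \<le> j" if "k \<in> {i..<i + p}" for k
      using strict_mono_on_less_eq[OF mono that j] .
    then have "{y \<in> \<tau> ` {i..<i + p}. y \<le> \<tau> j} = \<tau> ` {i..j}"
      using j by auto
    then show "card {y \<in> \<tau> ` {i..<i + p}. y \<le> \<tau> j} = Suc j - i"
      by (simp add: card_image inj_on_subset[OF assms])
  qed
qed

text \<open>
  Both the window of \<open>\<sigma>\<close> and the pattern arise by composing with the same exchange, which permutes
  the positions of the window. Cancelling it leaves the statement that the entries of
  \<open>\<sigma> \<circ> swap i\<close> have ranks \<open>1, 2, \<dots>, p\<close>.
\<close>
lemma red_eq_pattern_iff:
  assumes "\<sigma> permutes {1..n}" "1 \<le> i" "i + p \<le> Suc n" "3 \<le> p"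
  shows "red (map \<sigma> [i..<i + p]) = pattern1324 p \<longleftrightarrow> match_at p n i \<sigma>"
proof -
  define \<tau> where "\<tau> = \<sigma> \<circ> swap i"
  define r where "r j = card {y \<in> \<tau> ` {i..<i + p}. y \<le> \<tau> j}" for j
  have \<sigma>: "\<sigma> = \<tau> \<circ> swap i"
    by (simp add: \<tau>_def comp_assoc)
  have perm: "\<tau> permutes {1..n}"
    unfolding \<tau>_def using assms by (intro permutes_comp_swap) auto
  have swap_perm: "swap i permutes {i..<i + p}"
    using assms(4) by (intro permutes_swap_id) auto
  have img: "\<sigma> ` {i..<i + p} = \<tau> ` {i..<i + p}"
    unfolding \<sigma> image_comp[symmetric] permutes_image[OF swap_perm] ..
  have "red (map \<sigma> [i..<i + p]) = map (\<lambda>j. r (swap i j)) [i..<i + p]"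
    by (simp add: red_def img r_def) (simp add: \<sigma>)
  moreover have "pattern1324 p = map (\<lambda>j. Suc (swap i j) - i) [i..<i + p]"
    using assms(2)
    by (intro nth_equalityI) (auto simp: pattern1324_def transpose_def nth_append simp del: upt_Suc)
  ultimately have "red (map \<sigma> [i..<i + p]) = pattern1324 p
      \<longleftrightarrow> (\<forall>j\<in>{i..<i + p}. r (swap i j) = Suc (swap i j) - i)"
    by simp
  also have "\<dots> \<longleftrightarrow> (\<forall>j\<in>swap i ` {i..<i + p}. r j = Suc j - i)"
    by simp
  also have "\<dots> \<longleftrightarrow> (\<forall>j\<in>{i..<i + p}. r j = Suc j - i)"
    unfolding permutes_image[OF swap_perm] ..
  also have "\<dots> \<longleftrightarrow> strict_mono_on {i..<i + p} \<tau>"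
    unfolding r_def by (rule ranks_consecutive_iff_strict_mono_on[OF permutes_inj[OF perm]])
  also have "\<dots> \<longleftrightarrow> match_at p n i \<sigma>"
    using Des_disjoint_iff_strict_mono_on[OF perm assms(2,3)] by (simp add: match_at_def \<tau>_def)
  finally show ?thesis .
qed

lemma match_at_Des:
  assumes "\<sigma> permutes {1..n}" "1 \<le> i" "i + p \<le> Suc n" "4 \<le> p" "match_at p n i \<sigma>"
  shows "Des n \<sigma> = insert (Suc i) (Des n (\<sigma> \<circ> swap i))" "Suc i \<notin> Des n (\<sigma> \<circ> swap i)"
  using Des_comp_swap[of "\<sigma> \<circ> swap i" n i p] permutes_comp_swap[OF assms(1,2)] assms
  by (auto simp: match_at_def swap_comp_swap)

text \<open>
  \<open>\<sigma> \<mapsto> \<sigma> \<circ> swap i\<close> is a bijection onto the permutations with a single descent \<open>b\<close> that are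
  increasing on the window. For \<open>b = 0\<close> and \<open>b = n\<close> the summand is 0.
\<close>
lemma card_match_one:
  assumes "1 \<le> i" "i + p \<le> Suc n" "4 \<le> p"
  shows "real (card {\<sigma> \<in> two_desc n. match_at p n i \<sigma>})
    = (\<Sum>b\<in>{..n} - {i..<i + p - 1}. real (n choose b) - 1)"
proof -
  define E where "E = {\<tau>. \<tau> permutes {1..n} \<and> card (Des n \<tau>) = 1 \<and> Des n \<tau> \<inter> {i..<i + p - 1} = {}}"
  have swap: "(\<sigma> \<circ> swap i) permutes {1..n}" if "\<sigma> permutes {1..n}" for \<sigma>
    using permutes_comp_swap[OF that] assms by simp
  have "bij_betw (\<lambda>\<sigma>. \<sigma> \<circ> swap i) {\<sigma> \<in> two_desc n. match_at p n i \<sigma>} E"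
  proof (rule bij_betw_byWitness[where f' = "\<lambda>\<tau>. \<tau> \<circ> swap i"])
    show "(\<lambda>\<sigma>. \<sigma> \<circ> swap i) ` {\<sigma> \<in> two_desc n. match_at p n i \<sigma>} \<subseteq> E"
      using match_at_Des[OF _ assms] swap by (fastforce simp: E_def two_desc_def match_at_def)
    show "(\<lambda>\<tau>. \<tau> \<circ> swap i) ` E \<subseteq> {\<sigma> \<in> two_desc n. match_at p n i \<sigma>}"
      using Des_comp_swap[OF _ assms] swap assms
      by (fastforce simp: E_def two_desc_def match_at_def swap_comp_swap card_insert_if)
  qed (simp_all add: swap_comp_swap)
  then have "card {\<sigma> \<in> two_desc n. match_at p n i \<sigma>} = card E"
    by (rule bij_betw_same_card)
  also have "E = (\<Union>b\<in>{..n} - {i..<i + p - 1}. desc_exactly n {b})"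
    using Des_subset[of n] by (fastforce simp: E_def desc_exactly_def card_1_singleton_iff)
  also have "card \<dots> = (\<Sum>b\<in>{..n} - {i..<i + p - 1}. card (desc_exactly n {b}))"
    by (rule card_UN_disjoint) (simp_all, auto simp: desc_exactly_def)
  finally show ?thesis
    by (simp add: card_desc_exactly_single)
qed

lemma Des_comp_swap_right:
  assumes "i + 3 \<le> j"
  shows "Des n (\<sigma> \<circ> swap i) \<inter> {j..<u} = Des n \<sigma> \<inter> {j..<u}"
  using assms by (auto simp: Des_def transpose_def)

lemma swap_commute:
  assumes "i + 2 \<le> j"
  shows "swap i \<circ> swap j = swap j \<circ> swap i"
  using assms by (auto simp: fun_eq_iff transpose_def)

lemma match_at_comp_swap:
  assumes "i + 3 \<le> j"
  shows "match_at p n j (\<sigma> \<circ> swap i) \<longleftrightarrow> match_at p n j \<sigma>"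
proof -
  have "\<sigma> \<circ> swap i \<circ> swap j = \<sigma> \<circ> swap j \<circ> swap i"
    using swap_commute[of i j] assms by (simp add: comp_assoc)
  then show ?thesis
    by (simp add: match_at_def Des_comp_swap_right[OF assms])
qed

text \<open>
  If the second window starts before \<open>i + p - 2\<close>, its descent at \<open>j + 1\<close> would survive the first
  exchange inside the first window. Otherwise the two exchanges commute and do not disturb each other,
  and undoing both removes all descents; so \<open>swap j \<circ> swap i\<close> is the only such permutation.
\<close>
lemma card_match_two:
  assumes "1 \<le> i" "i < j" "j + p \<le> Suc n" "5 \<le> p"
  shows "card {\<sigma> \<in> two_desc n. match_at p n i \<sigma> \<and> match_at p n j \<sigma>} = of_bool (i + p \<le> j + 2)"
proof (cases "i + p \<le> j + 2")
  case False
  have "\<not> (match_at p n i \<sigma> \<and> match_at p n j \<sigma>)" if "\<sigma> permutes {1..n}" for \<sigma>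
  proof
    assume *: "match_at p n i \<sigma> \<and> match_at p n j \<sigma>"
    then have "Suc j \<in> Des n \<sigma>"
      using match_at_Des[OF that, of j p] assms by simp
    moreover have "Des n \<sigma> = insert (Suc i) (Des n (\<sigma> \<circ> swap i))"
      using * match_at_Des[OF that, of i p] assms by simp
    ultimately have "Suc j \<in> Des n (\<sigma> \<circ> swap i)"
      using assms by auto
    moreover have "Suc j \<in> {i..<i + p - 1}"
      using False assms by auto
    ultimately show False
      using * by (auto simp: match_at_def)
  qed
  then have none: "{\<sigma> \<in> two_desc n. match_at p n i \<sigma> \<and> match_at p n j \<sigma>} = {}"
    by (auto simp: two_desc_def)
  show ?thesis
    using False by (simp add: none)
next
  case True
  then have ij: "i + 3 \<le> j"
    using assms by simp
  have "{\<sigma> \<in> two_desc n. match_at p n i \<sigma> \<and> match_at p n j \<sigma>} = {swap j \<circ> swap i}"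
  proof (intro subset_antisym subsetI)
    fix \<sigma> assume "\<sigma> \<in> {\<sigma> \<in> two_desc n. match_at p n i \<sigma> \<and> match_at p n j \<sigma>}"
    then have \<sigma>: "\<sigma> permutes {1..n}" "card (Des n \<sigma>) = 2" "match_at p n i \<sigma>" "match_at p n j \<sigma>"
      by (auto simp: two_desc_def)
    define \<tau> where "\<tau> = \<sigma> \<circ> swap i"
    define \<rho> where "\<rho> = \<tau> \<circ> swap j"
    have \<tau>: "\<tau> permutes {1..n}" "match_at p n j \<tau>"
      unfolding \<tau>_def match_at_comp_swap[OF ij]
      using permutes_comp_swap[OF \<sigma>(1), of i] \<sigma>(4) assms by simp_all
    have \<rho>: "\<rho> permutes {1..n}"
      unfolding \<rho>_def using permutes_comp_swap[OF \<tau>(1), of j] assms by simp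
    have "Des n \<sigma> = insert (Suc i) (Des n \<tau>)" "Suc i \<notin> Des n \<tau>"
      using match_at_Des[OF \<sigma>(1), of i p] \<sigma>(3) assms by (simp_all add: \<tau>_def)
    moreover have "Des n \<tau> = insert (Suc j) (Des n \<rho>)" "Suc j \<notin> Des n \<rho>"
      using match_at_Des[OF \<tau>(1), of j p] \<tau>(2) assms by (simp_all add: \<rho>_def)
    ultimately have "Des n \<rho> = {}"
      using \<sigma>(2) by simp
    then have "\<rho> = id"
      using \<rho> desc_exactly_empty[of n] by (auto simp: desc_exactly_def)
    then have "\<sigma> = id \<circ> swap j \<circ> swap i"
      unfolding \<rho>_def \<tau>_def by (metis swap_comp_swap)
    then show "\<sigma> \<in> {swap j \<circ> swap i}" by simp
  next
    fix \<sigma> assume \<sigma>: "\<sigma> \<in> {swap j \<circ> swap i}"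
    have id: "Des n id = {}"
      by (simp add: Des_def)
    have perm: "swap j permutes {1..n}"
      using assms by (intro permutes_swap_id) auto
    have Dj: "Des n (swap j) = {Suc j}"
      using Des_comp_swap[of id n j p] assms by (simp add: permutes_id id)
    moreover have disj: "Des n (swap j) \<inter> {i..<i + p - 1} = {}"
      using Dj True assms by auto
    ultimately have "Des n (swap j \<circ> swap i) = {Suc i, Suc j}"
      using Des_comp_swap[OF perm, of i p] assms by simp
    moreover have "swap j \<circ> swap i permutes {1..n}"
      using permutes_comp_swap[OF perm] assms by simp
    moreover have "match_at p n i (swap j \<circ> swap i)"
      using disj by (simp add: match_at_def swap_comp_swap)
    moreover have "match_at p n j (swap j \<circ> swap i)"
      unfolding match_at_comp_swap[OF ij] by (simp add: match_at_def id)
    ultimately show "\<sigma> \<in> {\<sigma> \<in> two_desc n. match_at p n i \<sigma> \<and> match_at p n j \<sigma>}"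
      using \<sigma> assms by (simp add: two_desc_def)
  qed
  then show ?thesis
    using True by simp
qed

section \<open>Inclusion-exclusion and its evaluation\<close>

text \<open>
  Inclusion-exclusion in the form \<open>0 ^ k = 1 - k + (k choose 2)\<close>, valid for \<open>k \<le> 2\<close>, with the
  binomial coefficient written as a number of pairs.
\<close>
lemma bonferroni_two:
  fixes S :: "nat set"
  assumes "finite S" "card S \<le> 2"
  shows "of_bool (S = {}) = (1::real) - real (card S) + real (card {(i, j). i \<in> S \<and> j \<in> S \<and> i < j})"
proof -
  consider "card S = 0" | "card S = 1" | "card S = 2" using assms(2) by linarith
  then show ?thesis
  proof cases
    case 1
    then show ?thesis using assms(1) by simp
  next
    case 2
    then obtain x where "S = {x}" by (auto simp: card_1_singleton_iff)
    then have "{(i, j). i \<in> S \<and> j \<in> S \<and> i < j} = {}" "S \<noteq> {}" by auto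
    then show ?thesis using 2 by (simp only:) simp
  next
    case 3
    then obtain x y where "S = {x, y}" "x < y"
      by (auto simp: card_2_iff) (metis insert_commute linorder_neqE_nat)
    then have "{(i, j). i \<in> S \<and> j \<in> S \<and> i < j} = {(x, y)}" "S \<noteq> {}" by auto
    then show ?thesis using 3 by (simp only:) simp
  qed
qed

lemma d2_sieve:
  fixes n p :: nat
  assumes "5 \<le> p"
  defines "I \<equiv> {1..<n + 2 - p}"
  shows "real (d2 n p) = real (card (two_desc n))
    - (\<Sum>i\<in>I. real (card {\<sigma> \<in> two_desc n. match_at p n i \<sigma>}))
    + (\<Sum>j\<in>I. \<Sum>i\<in>I. of_bool (i + p \<le> j + 2))"
proof -
  define M where "M \<sigma> = {i \<in> I. match_at p n i \<sigma>}" for \<sigma>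
  have I: "1 \<le> i" "i + p \<le> Suc n" if "i \<in> I" for i
    using that by (auto simp: I_def)
  have finI: "finite I" by (simp add: I_def)
  have p3: "3 \<le> p" using assms(1) by simp
  have "has_match1324 p n \<sigma> \<longleftrightarrow> M \<sigma> \<noteq> {}" if "\<sigma> permutes {1..n}" for \<sigma>
  proof -
    have "has_match1324 p n \<sigma> \<longleftrightarrow> (\<exists>i\<ge>1. i + p \<le> Suc n \<and> match_at p n i \<sigma>)"
      using red_eq_pattern_iff[OF that _ _ p3] unfolding has_match1324_def by blast
    also have "\<dots> \<longleftrightarrow> M \<sigma> \<noteq> {}"
      by (fastforce simp: M_def I_def less_diff_conv)
    finally show ?thesis .
  qed
  then have "{\<sigma>. \<sigma> permutes {1..n} \<and> \<not> has_match1324 p n \<sigma> \<and> des n \<sigma> = 2} = {\<sigma> \<in> two_desc n. M \<sigma> = {}}"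
    by (auto simp: two_desc_def des_eq_card_Des)
  then have "real (d2 n p) = (\<Sum>\<sigma>\<in>two_desc n. of_bool (M \<sigma> = {}))"
    by (simp add: d2_def sum.If_cases of_bool_def Int_def)
  also have "\<dots> = (\<Sum>\<sigma>\<in>two_desc n.
      1 - real (card (M \<sigma>)) + real (card {(i, j). i \<in> M \<sigma> \<and> j \<in> M \<sigma> \<and> i < j}))"
  proof (intro sum.cong refl bonferroni_two)
    fix \<sigma> assume \<sigma>: "\<sigma> \<in> two_desc n"
    \<comment> \<open>Different matches use different descents, so there are at most two of them.\<close>
    have "Suc ` M \<sigma> \<subseteq> Des n \<sigma>"
      using match_at_Des(1)[of \<sigma> n _ p] \<sigma> I assms(1) by (fastforce simp: M_def two_desc_def)
    then have "card (Suc ` M \<sigma>) \<le> card (Des n \<sigma>)"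
      by (intro card_mono) simp_all
    then show "card (M \<sigma>) \<le> 2"
      using \<sigma> by (simp add: card_image two_desc_def)
    show "finite (M \<sigma>)"
      using finI by (simp add: M_def)
  qed
  also have "\<dots> = real (card (two_desc n)) - (\<Sum>\<sigma>\<in>two_desc n. real (card (M \<sigma>)))
      + (\<Sum>\<sigma>\<in>two_desc n. real (card {(i, j). i \<in> M \<sigma> \<and> j \<in> M \<sigma> \<and> i < j}))"
    by (simp add: sum.distrib sum_subtractf)
  also have "(\<Sum>\<sigma>\<in>two_desc n. real (card (M \<sigma>)))
      = (\<Sum>\<sigma>\<in>two_desc n. \<Sum>i\<in>I. of_bool (match_at p n i \<sigma>))"
    using finI by (simp add: M_def sum.If_cases of_bool_def Int_def)
  also have "\<dots> = (\<Sum>i\<in>I. \<Sum>\<sigma>\<in>two_desc n. of_bool (match_at p n i \<sigma>))"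
    by (rule sum.swap)
  also have "\<dots> = (\<Sum>i\<in>I. real (card {\<sigma> \<in> two_desc n. match_at p n i \<sigma>}))"
    by (simp add: sum.If_cases of_bool_def Int_def)
  also have "(\<Sum>\<sigma>\<in>two_desc n. real (card {(i, j). i \<in> M \<sigma> \<and> j \<in> M \<sigma> \<and> i < j}))
      = (\<Sum>\<sigma>\<in>two_desc n. \<Sum>(j, i)\<in>I \<times> I. of_bool (i < j \<and> match_at p n i \<sigma> \<and> match_at p n j \<sigma>))"
  proof (intro sum.cong refl)
    fix \<sigma>
    have "{(i, j). i \<in> M \<sigma> \<and> j \<in> M \<sigma> \<and> i < j}
        = prod.swap ` {(j, i) \<in> I \<times> I. i < j \<and> match_at p n i \<sigma> \<and> match_at p n j \<sigma>}"
      by (auto simp: M_def image_iff)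
    then have "card {(i, j). i \<in> M \<sigma> \<and> j \<in> M \<sigma> \<and> i < j}
        = card {(j, i) \<in> I \<times> I. i < j \<and> match_at p n i \<sigma> \<and> match_at p n j \<sigma>}"
      by (simp add: card_image)
    also have "{(j, i) \<in> I \<times> I. i < j \<and> match_at p n i \<sigma> \<and> match_at p n j \<sigma>}
        = I \<times> I \<inter> {(j, i). i < j \<and> match_at p n i \<sigma> \<and> match_at p n j \<sigma>}"
      by auto
    finally show "real (card {(i, j). i \<in> M \<sigma> \<and> j \<in> M \<sigma> \<and> i < j})
        = (\<Sum>(j, i)\<in>I \<times> I. of_bool (i < j \<and> match_at p n i \<sigma> \<and> match_at p n j \<sigma>))"
      using finI by (simp add: sum.If_cases of_bool_def case_prod_unfold)
  qed
  also have "\<dots> = (\<Sum>(j, i)\<in>I \<times> I. \<Sum>\<sigma>\<in>two_desc n. of_bool (i < j \<and> match_at p n i \<sigma> \<and> match_at p n j \<sigma>))"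
    unfolding case_prod_unfold by (rule sum.swap)
  also have "\<dots> = (\<Sum>(j, i)\<in>I \<times> I. of_bool (i + p \<le> j + 2))"
  proof (intro sum.cong refl, clarify)
    fix j i assume ji: "j \<in> I" "i \<in> I"
    show "(\<Sum>\<sigma>\<in>two_desc n. of_bool (i < j \<and> match_at p n i \<sigma> \<and> match_at p n j \<sigma>))
        = (of_bool (i + p \<le> j + 2) :: real)"
    proof (cases "i < j")
      case True
      then have "(\<Sum>\<sigma>\<in>two_desc n. of_bool (i < j \<and> match_at p n i \<sigma> \<and> match_at p n j \<sigma>))
          = real (card {\<sigma> \<in> two_desc n. match_at p n i \<sigma> \<and> match_at p n j \<sigma>})"
        by (simp add: sum.If_cases of_bool_def Int_def)
      then show ?thesis
        using card_match_two[OF I(1)[OF ji(2)] True I(2)[OF ji(1)] assms(1)] by simp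
    next
      case False
      then show ?thesis using assms(1) by simp
    qed
  qed
  also have "\<dots> = (\<Sum>j\<in>I. \<Sum>i\<in>I. of_bool (i + p \<le> j + 2))"
    by (simp add: sum.cartesian_product)
  finally show ?thesis .
qed

lemma sum_truncated_diff:
  assumes "1 \<le> p"
  shows "(\<Sum>b\<le>n. real (b + 1 - p)) = real (n + 1 - p) * (real (n + 1 - p) + 1) / 2"
proof (induction n)
  case 0
  then show ?case using assms by (cases "p = 1") auto
next
  case (Suc n)
  show ?case
  proof (cases "p \<le> Suc n")
    case True
    then have "Suc n + 1 - p = Suc (n + 1 - p)" by simp
    then show ?thesis using Suc by (simp add: field_simps)
  next
    case False
    then show ?thesis using Suc assms by (cases "p = Suc (Suc n)") auto
  qed
qed

lemma overlapping_pairs_sum: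
  fixes n p :: nat
  assumes "5 \<le> p"
  defines "I \<equiv> {1..<n + 2 - p}"
  shows "(\<Sum>j\<in>I. \<Sum>i\<in>I. of_bool (i + p \<le> j + 2)) = real (n + 3 - 2 * p) * (real (n + 3 - 2 * p) + 1) / 2"
proof -
  have "(\<Sum>j\<in>I. \<Sum>i\<in>I. of_bool (i + p \<le> j + 2)) = (\<Sum>j\<in>I. real (j + 1 - (p - 1)))"
  proof (intro sum.cong refl)
    fix j assume "j \<in> I"
    then have "{i \<in> I. i + p \<le> j + 2} = {1..j + 1 - (p - 1)}"
      using assms(1) by (auto simp: I_def)
    then show "(\<Sum>i\<in>I. of_bool (i + p \<le> j + 2)) = real (j + 1 - (p - 1))"
      by (simp add: sum.If_cases of_bool_def Int_def I_def)
  qed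
  also have "\<dots> = (\<Sum>j\<le>n + 1 - p. real (j + 1 - (p - 1)))"
    using assms(1) by (intro sum.mono_neutral_left) (auto simp: I_def)
  also have "\<dots> = real (n + 3 - 2 * p) * (real (n + 3 - 2 * p) + 1) / 2"
  proof -
    have "n + 1 - p + 1 - (p - 1) = n + 3 - 2 * p"
      using assms(1) by simp
    then show ?thesis
      using sum_truncated_diff[of "p - 1" "n + 1 - p"] assms(1) by simp
  qed
  finally show ?thesis .
qed

text \<open>
  The descent \<open>b\<close> lies before or after the window; the symmetry \<open>b \<mapsto> n - b\<close> of the binomial
  coefficients makes both parts equal. In the second part, exactly
  \<open>b + 1 - p\<close> windows end at or before \<open>b\<close>, with the difference truncated at 0. This truncated
  difference is \<open>real b + 1 - real p\<close> plus the truncated \<open>p - 1 - b\<close>, which separates a full binomial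
  sum from one over \<open>b \<le> p - 2\<close>.
\<close>
lemma single_match_sum:
  assumes "2 \<le> p"
  shows "(\<Sum>i\<in>{1..<n + 2 - p}. \<Sum>b\<in>{..n} - {i..<i + p - 1}. real (n choose b) - 1)
    = real n * 2 ^ n - (2 * real p - 2) * 2 ^ n
      + 2 * (\<Sum>b\<le>p - 2. (real p - 1 - real b) * real (n choose b))
      - real (n + 1 - p) * (real (n + 1 - p) + 1)"
proof -
  define I where "I = {1..<n + 2 - p}"
  define h where "h b = real (n choose b) - 1" for b
  have "(\<Sum>i\<in>I. \<Sum>b\<in>{..n} - {i..<i + p - 1}. h b)
      = (\<Sum>i\<in>I. (\<Sum>b\<in>{..<i}. h b) + (\<Sum>b\<in>{i + p - 1..n}. h b))"
  proof (intro sum.cong refl)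
    fix i assume "i \<in> I"
    then have "{..n} - {i..<i + p - 1} = {..<i} \<union> {i + p - 1..n}"
      using assms by (auto simp: I_def)
    then show "(\<Sum>b\<in>{..n} - {i..<i + p - 1}. h b) = (\<Sum>b\<in>{..<i}. h b) + (\<Sum>b\<in>{i + p - 1..n}. h b)"
      using assms by (subst sum.union_disjoint[symmetric]) auto
  qed
  also have "\<dots> = (\<Sum>i\<in>I. \<Sum>b\<in>{..<i}. h b) + (\<Sum>i\<in>I. \<Sum>b\<in>{i + p - 1..n}. h b)"
    by (rule sum.distrib)
  also have "(\<Sum>i\<in>I. \<Sum>b\<in>{..<i}. h b) = (\<Sum>i\<in>I. \<Sum>b\<in>{i + p - 1..n}. h b)"
  proof (rule sum.reindex_bij_witness[where i = "\<lambda>i. n + 2 - p - i" and j = "\<lambda>i. n + 2 - p - i"])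
    fix i assume i: "i \<in> I"
    show "(\<Sum>b\<in>{n + 2 - p - i + p - 1..n}. h b) = (\<Sum>b\<in>{..<i}. h b)"
      by (rule sum.reindex_bij_witness[where i = "\<lambda>b. n - b" and j = "\<lambda>b. n - b"])
        (use i assms in \<open>auto simp: I_def h_def binomial_symmetric[symmetric]\<close>)
  qed (auto simp: I_def)
  also have "(\<Sum>i\<in>I. \<Sum>b\<in>{i + p - 1..n}. h b) = (\<Sum>b\<le>n. real (b + 1 - p) * h b)"
  proof -
    have "(\<Sum>i\<in>I. \<Sum>b\<in>{i + p - 1..n}. h b) = (\<Sum>i\<in>I. \<Sum>b\<le>n. of_bool (i + p - 1 \<le> b) * h b)"
      by (intro sum.cong refl sum.mono_neutral_cong_left) auto
    also have "\<dots> = (\<Sum>b\<le>n. \<Sum>i\<in>I. of_bool (i + p - 1 \<le> b) * h b)"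
      by (rule sum.swap)
    also have "\<dots> = (\<Sum>b\<le>n. real (b + 1 - p) * h b)"
    proof (intro sum.cong refl)
      fix b assume "b \<in> {..n}"
      then have "{i \<in> I. i + p - 1 \<le> b} = {1..b + 1 - p}"
        using assms by (auto simp: I_def)
      then have "(\<Sum>i\<in>I. of_bool (i + p - 1 \<le> b)) = real (b + 1 - p)"
        by (simp add: sum.If_cases of_bool_def Int_def I_def)
      then show "(\<Sum>i\<in>I. of_bool (i + p - 1 \<le> b) * h b) = real (b + 1 - p) * h b"
        by (simp flip: sum_distrib_right)
    qed
    finally show ?thesis .
  qed
  also have "(\<Sum>b\<le>n. real (b + 1 - p) * h b)
      = (\<Sum>b\<le>n. real (b + 1 - p) * real (n choose b)) - (\<Sum>b\<le>n. real (b + 1 - p))"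
    by (simp add: h_def algebra_simps sum_subtractf)
  also have "(\<Sum>b\<le>n. real (b + 1 - p)) = real (n + 1 - p) * (real (n + 1 - p) + 1) / 2"
    using sum_truncated_diff assms by simp
  also have "(\<Sum>b\<le>n. real (b + 1 - p) * real (n choose b))
      = (\<Sum>b\<le>n. real (b * (n choose b)) - (real p - 1) * real (n choose b)
           + real (p - 1 - b) * real (n choose b))"
  proof (intro sum.cong refl)
    fix b
    have "real (b + 1 - p) = real b - (real p - 1) + real (p - 1 - b)"
      using assms by (cases "p \<le> b + 1") (auto simp: of_nat_diff)
    then show "real (b + 1 - p) * real (n choose b)
        = real (b * (n choose b)) - (real p - 1) * real (n choose b) + real (p - 1 - b) * real (n choose b)"
      by (simp only: of_nat_mult) (simp only: ring_distribs)
  qed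
  also have "\<dots> = real (\<Sum>b\<le>n. b * (n choose b)) - (real p - 1) * real (\<Sum>b\<le>n. n choose b)
      + (\<Sum>b\<le>n. real (p - 1 - b) * real (n choose b))"
    by (simp add: sum.distrib sum_subtractf sum_distrib_left)
  also have "(\<Sum>b\<le>n. real (p - 1 - b) * real (n choose b))
      = (\<Sum>b\<le>p - 2. (real p - 1 - real b) * real (n choose b))"
  proof -
    have "(\<Sum>b\<le>n. real (p - 1 - b) * real (n choose b))
        = (\<Sum>b\<le>n + p. real (p - 1 - b) * real (n choose b))"
      by (intro sum.mono_neutral_left) auto
    also have "\<dots> = (\<Sum>b\<le>p - 2. (real p - 1 - real b) * real (n choose b))"
      using assms by (intro sum.mono_neutral_cong_right) (auto simp: of_nat_diff)
    finally show ?thesis .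
  qed
  finally have "(\<Sum>i\<in>I. \<Sum>b\<in>{..n} - {i..<i + p - 1}. h b)
    = 2 * (real (n * 2 ^ (n - 1)) - (real p - 1) * 2 ^ n)
      + 2 * (\<Sum>b\<le>p - 2. (real p - 1 - real b) * real (n choose b))
      - real (n + 1 - p) * (real (n + 1 - p) + 1)"
    by (simp add: choose_linear_sum choose_row_sum algebra_simps)
  moreover have "2 * real (n * 2 ^ (n - 1)) = real n * 2 ^ n"
    by (cases n) (auto simp: algebra_simps)
  ultimately show ?thesis
    by (simp add: I_def h_def algebra_simps)
qed

lemma d2_closed_form:
  assumes "5 \<le> p"
  shows "real (d2 n p) = 3 ^ n + (2 * real p - 3 - 2 * real n) * 2 ^ n + real n * (real n + 1) / 2
    - 2 * (\<Sum>k\<le>p - 2. (real p - 1 - real k) * real (n choose k))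
    + real (n + 1 - p) * (real (n + 1 - p) + 1)
    + real (n + 3 - 2 * p) * (real (n + 3 - 2 * p) + 1) / 2"
proof -
  have "(\<Sum>i\<in>{1..<n + 2 - p}. real (card {\<sigma> \<in> two_desc n. match_at p n i \<sigma>}))
      = (\<Sum>i\<in>{1..<n + 2 - p}. \<Sum>b\<in>{..n} - {i..<i + p - 1}. real (n choose b) - 1)"
    using assms by (intro sum.cong refl card_match_one) auto
  moreover have "2 \<le> p"
    using assms by simp
  ultimately show ?thesis
    unfolding d2_sieve[OF assms] overlapping_pairs_sum[OF assms] card_two_desc
    by (simp only: single_match_sum) (simp add: field_simps)
qed

section \<open>The generating function\<close>

lemma X_power_fps_exp_nth:
  "fps_nth (fps_const c * fps_X ^ k * fps_exp a) n
    = c * a ^ (n - k) * fact k * of_nat (n choose k) / (fact n :: 'a :: field_char_0)"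
proof (cases "k \<le> n")
  case True
  then show ?thesis
    by (simp add: mult.assoc fps_X_power_mult_nth binomial_fact)
qed (simp add: mult.assoc fps_X_power_mult_nth binomial_eq_0)

text \<open>
  Compared with \<open>d2_closed_form\<close>, the terms \<open>k \<le> 2\<close> of the sum are made explicit and
  the truncated differences are replaced by the polynomials that they agree with for \<open>n \<ge> 2 * p - 2\<close>;
  the last three summands are the resulting errors for smaller \<open>n\<close>.
\<close>
lemma d2_coefficient:
  assumes "5 \<le> p"
  shows "real (d2 n p) = 3 ^ n + (2 * real p - 3 - 2 * real n) * 2 ^ n
      + 3 * real p ^ 2 - 12 * real p + 10 + (13 - 6 * real p) * real n
      + (5 - real p) * real n * (real n - 1)
      - (\<Sum>k = 3..p - 2. 2 * (real p - real k - 1) * real (n choose k))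
      + (if n = 0 then 2 * real p - 1 else 0)
      + (if 1 \<le> n \<and> n \<le> p - 2 then 2 * (real p - real n - 1) else 0)
      + (if n \<le> 2 * p - 3 then corr n p else 0)"
proof -
  have "{..p - 2} = insert 0 (insert 1 (insert 2 {3..p - 2}))"
    using assms by auto
  then have "2 * (\<Sum>k\<le>p - 2. (real p - 1 - real k) * real (n choose k))
      = 2 * (real p - 1) + 2 * (real p - 2) * real n + (real p - 3) * real n * (real n - 1)
        + (\<Sum>k = 3..p - 2. 2 * (real p - real k - 1) * real (n choose k))"
  proof -
    have choose_2: "real (n choose 2) = real n * (real n - 1) / 2"
      by (cases n) (auto simp: choose_two real_of_nat_div field_simps)
    show ?thesis
      unfolding \<open>{..p - 2} = _\<close> by (simp add: choose_2 sum_distrib_left) (simp add: algebra_simps)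
  qed
  note closed = d2_closed_form[OF assms, of n, unfolded this]
  \<comment> \<open>At \<open>n = p - 1\<close> and \<open>n = p\<close> the summand for \<open>n \<le> p - 2\<close> is already absent while
    \<open>corr\<close> still has its middle form.\<close>
  consider "n = 0" | "n = 1" | "n = 2" | "3 \<le> n" "n \<le> p - 2" | "n = p - 1" | "n = p"
    | "p + 1 \<le> n" "n \<le> 2 * p - 3" | "2 * p - 2 \<le> n"
    using assms by force
  then show ?thesis
  proof cases
    case 1
    then show ?thesis
      unfolding closed using assms by (simp add: corr_def field_simps power2_eq_square)
  next
    case 2
    then have "1 \<le> p - 2" "1 \<le> 2 * p - 3" "1 + 1 - p = 0" "1 + 3 - 2 * p = 0"
      using assms by auto
    then show ?thesis
      unfolding closed unfolding 2 by (simp add: corr_def field_simps power2_eq_square)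
  next
    case 3
    then have "2 \<le> p - 2" "2 \<le> 2 * p - 3" "2 + 1 - p = 0" "2 + 3 - 2 * p = 0"
      using assms by auto
    then show ?thesis
      unfolding closed unfolding 3 by (simp add: corr_def field_simps power2_eq_square)
  next
    case 4
    then have "n + 1 - p = 0" "n + 3 - 2 * p = 0" "n \<le> p" "n \<le> 2 * p - 3" using assms by auto
    then show ?thesis
      unfolding closed using 4 assms by (simp add: corr_def field_simps power2_eq_square)
  next
    case 5
    then have "n \<noteq> 0" "n \<noteq> 1" "n \<noteq> 2" "n \<le> p" "n \<le> 2 * p - 3" "\<not> n \<le> p - 2"
      and "n + 1 - p = 0" "n + 3 - 2 * p = 0" "real p = real n + 1"
      using assms by auto
    then show ?thesis
      unfolding closed by (simp add: corr_def field_simps power2_eq_square)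
  next
    case 6
    then have "n \<noteq> 0" "n \<noteq> 1" "n \<noteq> 2" "n \<le> p" "n \<le> 2 * p - 3" "\<not> n \<le> p - 2"
      and "n + 1 - p = 1" "n + 3 - 2 * p = 0" "real p = real n"
      using assms by auto
    then show ?thesis
      unfolding closed by (simp add: corr_def field_simps power2_eq_square)
  next
    case 7
    then have "real (n + 1 - p) = real n + 1 - real p" "n + 3 - 2 * p = 0" using assms by auto
    then show ?thesis
      unfolding closed using 7 assms by (simp add: corr_def field_simps power2_eq_square)
  next
    case 8
    then have "real (n + 1 - p) = real n + 1 - real p" "real (n + 3 - 2 * p) = real n + 3 - 2 * real p"
      and "n \<noteq> 0" "\<not> n \<le> p - 2" "\<not> n \<le> 2 * p - 3"
      using 8 assms by (auto simp: of_nat_diff)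
    then show ?thesis
      unfolding closed by (simp add: field_simps power2_eq_square)
  qed
qed

lemma X_power_nth:
  "fps_nth (fps_const c * fps_X ^ k) n = (if n = k then c else 0 :: real)"
  by (simp add: fps_X_power_iff)

theorem mainTheorem6:
  fixes p :: nat
  assumes "p \<ge> 5"
  shows "Abs_fps (\<lambda>n. real (d2 n p) / fact n) =
      fps_exp 3
      + (fps_const (2 * real p - 3) - fps_const 4 * fps_X) * fps_exp 2
      + (fps_const (3 * real p ^ 2 - 12 * real p + 10)
          + fps_const (13 - 6 * real p) * fps_X
          + fps_const (5 - real p) * fps_X ^ 2
          - (\<Sum>n = 3..p - 2. fps_const (2 * (real p - real n - 1) / fact n) * fps_X ^ n))
        * fps_exp 1
      + fps_const (2 * real p - 1)
      + (\<Sum>n = 1..p - 2. fps_const (2 * (real p - real n - 1) / fact n) * fps_X ^ n)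
      + (\<Sum>n = 0..2 * p - 3. fps_const (corr n p / fact n) * fps_X ^ n)
    \<and> (\<forall>n \<ge> 2 * p - 2. real (d2 n p) =
      3 ^ n + (2 * real p - 3 - 2 * real n) * 2 ^ n
      + 3 * real p ^ 2 - 12 * real p + 10
      + (13 - 6 * real p) * real n
      + (5 - real p) * real n * (real n - 1)
      - (\<Sum>k = 3..p - 2. 2 * (real p - real k - 1) / fact k * (\<Prod>j<k. real n - real j)))"
    (is "_ = ?F \<and> (\<forall>n \<ge> _. _ = ?G n)")
proof (intro conjI allI impI)
  show "Abs_fps (\<lambda>n. real (d2 n p) / fact n) = ?F"
  proof (rule fps_ext)
    fix n
    have pred: "4 * 2 ^ (n - 1) * real n = 2 * real n * 2 ^ n"
      by (cases n) auto
    have choose_2: "real (n choose 2) = real n * (real n - 1) / 2"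
      by (cases n) (auto simp: choose_two real_of_nat_div field_simps)
    have linear: "fps_nth ((fps_const (2 * real p - 3) - fps_const 4 * fps_X) * fps_exp 2) n
        = ((2 * real p - 3) * 2 ^ n - 2 * real n * 2 ^ n) / fact n"
    proof -
      have "fps_nth (fps_const 4 * fps_X * fps_exp (2 :: real)) n = 2 * real n * 2 ^ n / fact n"
        using X_power_fps_exp_nth[of 4 1 "2 :: real" n]
        by (simp only: power_one_right fact_1 choose_one mult_1_right pred)
      then show ?thesis
        by (simp only: left_diff_distrib fps_sub_nth) (simp add: diff_divide_distrib left_diff_distrib)
    qed
    have sums: "fps_nth ((\<Sum>k = 3..p - 2. fps_const (2 * (real p - real k - 1) / fact k) * fps_X ^ k) * fps_exp 1) n
        = (\<Sum>k = 3..p - 2. 2 * (real p - real k - 1) * real (n choose k)) / fact n"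
      by (simp add: sum_distrib_right fps_sum_nth X_power_fps_exp_nth sum_divide_distrib)
    have poly: "fps_nth ((fps_const (3 * real p ^ 2 - 12 * real p + 10)
          + fps_const (13 - 6 * real p) * fps_X
          + fps_const (5 - real p) * fps_X ^ 2
          - (\<Sum>n = 3..p - 2. fps_const (2 * (real p - real n - 1) / fact n) * fps_X ^ n))
        * fps_exp 1) n
      = (3 * real p ^ 2 - 12 * real p + 10 + (13 - 6 * real p) * real n
         + (5 - real p) * real n * (real n - 1)
         - (\<Sum>k = 3..p - 2. 2 * (real p - real k - 1) * real (n choose k))) / fact n"
    proof -
      have "fps_nth (fps_const (13 - 6 * real p) * fps_X * fps_exp 1) n
          = (13 - 6 * real p) * real n / fact n"
        using X_power_fps_exp_nth[of "13 - 6 * real p" 1 1 n] by simp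
      moreover have "fps_nth (fps_const (5 - real p) * fps_X ^ 2 * fps_exp 1) n
          = (5 - real p) * real n * (real n - 1) / fact n"
        unfolding X_power_fps_exp_nth choose_2 by (simp add: field_simps)
      moreover have "fps_nth (fps_const (3 * real p ^ 2 - 12 * real p + 10) * fps_exp 1) n
          = (3 * real p ^ 2 - 12 * real p + 10) / fact n"
        by simp
      ultimately show ?thesis
        by (simp only: left_diff_distrib[of _ _ "fps_exp 1"] distrib_right[of _ _ "fps_exp 1"]
            fps_sub_nth fps_add_nth sums diff_divide_distrib add_divide_distrib)
    qed
    have lower: "fps_nth (\<Sum>n = 1..p - 2. fps_const (2 * (real p - real n - 1) / fact n) * fps_X ^ n) n
        = (if 1 \<le> n \<and> n \<le> p - 2 then 2 * (real p - real n - 1) else 0) / fact n"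
      unfolding fps_sum_nth X_power_nth by (subst sum.delta') auto
    have corrections: "fps_nth (\<Sum>n = 0..2 * p - 3. fps_const (corr n p / fact n) * fps_X ^ n) n
        = (if n \<le> 2 * p - 3 then corr n p else 0) / fact n"
      unfolding fps_sum_nth X_power_nth by (subst sum.delta') auto
    have const: "fps_nth (fps_const (2 * real p - 1)) n = (if n = 0 then 2 * real p - 1 else 0) / fact n"
      by simp
    show "fps_nth (Abs_fps (\<lambda>n. real (d2 n p) / fact n)) n = fps_nth ?F n"
      unfolding fps_add_nth linear poly lower corrections const fps_nth_Abs_fps
        d2_coefficient[OF assms] fps_exp_nth
      by (simp add: add_divide_distrib[symmetric] algebra_simps)
  qed
next
  fix n :: nat assume "2 * p - 2 \<le> n"
  then have "\<not> n \<le> 2 * p - 3" "\<not> n \<le> p - 2" "n \<noteq> 0"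
    using assms by auto
  moreover have "real (n choose k) = (\<Prod>j<k. real n - real j) / fact k" for k
    by (simp add: binomial_gbinomial gbinomial_prod_rev lessThan_atLeast0)
  ultimately show "real (d2 n p) = ?G n"
    unfolding d2_coefficient[OF assms] by simp
qed

end
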